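(* Let $(\mathfrak{A},\mathsf{L})$ be a quantum compact metric space such that $\mathsf{L}$ is lower semi-continuous on $\mathfrak{sa}(\mathfrak{A})$, i.e. $\{a\in\mathrm{dom}(\mathsf{L}) : \mathsf{L}(a)\leq 1\}$ is closed in $(\mathfrak{A},\|\cdot\|_{\mathfrak{A}})$. Let $\mathsf{S}$ be a seminorm on $\mathrm{dom}(\mathsf{L})$ such that: (1) $\mathsf{S}$ is lower semi-continuous on $\mathfrak{sa}(\mathfrak{A})$ with respect to $\|\cdot\|_{\mathfrak{A}}$, i.e. $\{a\in\mathrm{dom}(\mathsf{S}) : \mathsf{S}(a)\leq 1\}$ is a closed subset of $(\mathfrak{A},\|\cdot\|_{\mathfrak{A}})$; (2) $\mathsf{S}(1_{\mathfrak{A}})=0$. Then there exists $C>0$ such that for all $a\in\mathrm{dom}(\mathsf{L})$: $\mathsf{S}(a)\leq C\,\mathsf{L}(a)$.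
   Context: For a unital C*-algebra $\mathfrak{A}$ with unit $1_{\mathfrak{A}}$ and norm $\|\cdot\|_{\mathfrak{A}}$, $\mathfrak{sa}(\mathfrak{A})$ is the space of self-adjoint elements and $\mathscr{S}(\mathfrak{A})$ the state space. A quantum compact metric space $(\mathfrak{A},\mathsf{L})$ is a unital C*-algebra $\mathfrak{A}$ with a seminorm $\mathsf{L}$ (called a Lip-norm) defined on a dense subspace $\mathrm{dom}(\mathsf{L})$ of $\mathfrak{sa}(\mathfrak{A})$ such that $\{a\in\mathrm{dom}(\mathsf{L}):\mathsf{L}(a)=0\}=\mathbb{R}1_{\mathfrak{A}}$ and the Monge-Kantorovich metric $\mathsf{mk}_{\mathsf{L}}(\varphi,\psi)=\sup\{|\varphi(a)-\psi(a)| : a\in\mathrm{dom}(\mathsf{L}),\ \mathsf{L}(a)\leq 1\}$ metrizes the weak* topology on $\mathscr{S}(\mathfrak{A})$. Here $\mathrm{dom}(\mathsf{S})$ denotes the subspace on which the seminorm $\mathsf{S}$ is defined; a seminorm is regarded as taking the value $\infty$ outside its domain. *)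

theory Defs
  imports "HOL-Analysis.Analysis"
begin

text \<open>
  The norm, the real scalar multiplication and completeness come from
  \<^class>\<open>real_normed_algebra_1\<close> and \<^class>\<open>banach\<close>; the class adds the complex scalars extending the
  real ones, the involution and the C*-identity. As usual for unital C*-algebras,
  the zero algebra is excluded (\<^prop>\<open>norm 1 = 1\<close>, which the C*-identity implies when \<open>1 \<noteq> 0\<close>).
\<close>

class unital_cstar_algebra = real_normed_algebra_1 + banach +
  fixes scaleC :: "complex \<Rightarrow> 'a \<Rightarrow> 'a"  (infixr "*\<^sub>C" 75)
    and star :: "'a \<Rightarrow> 'a"
  assumes scaleC_add_right: "c *\<^sub>C (x + y) = c *\<^sub>C x + c *\<^sub>C y"
    and scaleC_add_left: "(c + d) *\<^sub>C x = c *\<^sub>C x + d *\<^sub>C x"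
    and scaleC_scaleC: "c *\<^sub>C (d *\<^sub>C x) = (c * d) *\<^sub>C x"
    and scaleR_eq_scaleC: "scaleR r x = complex_of_real r *\<^sub>C x"
    and mult_scaleC_left: "(c *\<^sub>C x) * y = c *\<^sub>C (x * y)"
    and mult_scaleC_right: "x * (c *\<^sub>C y) = c *\<^sub>C (x * y)"
    and norm_scaleC: "norm (c *\<^sub>C x) = cmod c * norm x"
    and star_star: "star (star x) = x"
    and star_add: "star (x + y) = star x + star y"
    and star_scaleC: "star (c *\<^sub>C x) = cnj c *\<^sub>C star x"
    and star_mult: "star (x * y) = star y * star x"
    and cstar_identity: "norm (star x * x) = (norm x)\<^sup>2"

definition self_adjoint :: "'a::unital_cstar_algebra set" where
  "self_adjoint = {a. star a = a}"

definition complex_linear :: "('a::unital_cstar_algebra \<Rightarrow> complex) \<Rightarrow> bool" where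
  "complex_linear \<phi> \<longleftrightarrow>
     (\<forall>x y. \<phi> (x + y) = \<phi> x + \<phi> y) \<and> (\<forall>c x. \<phi> (c *\<^sub>C x) = c * \<phi> x)"

definition state_space :: "('a::unital_cstar_algebra \<Rightarrow> complex) set" where
  "state_space = {\<phi>. complex_linear \<phi> \<and> (\<forall>a. \<phi> (star a * a) \<in> \<real>\<^sub>\<ge>\<^sub>0) \<and> \<phi> 1 = 1}"

text \<open>The weak* topology is the topology of pointwise convergence on the algebra.\<close>

definition weak_star_topology :: "('a::unital_cstar_algebra \<Rightarrow> complex) topology" where
  "weak_star_topology = subtopology (product_topology (\<lambda>_. euclidean) UNIV) state_space"

text \<open>
  A seminorm with domain \<open>D\<close> is given by \<open>D\<close> and a real-valued function of which only the
  values on \<open>D\<close> matter; points outside \<open>D\<close> are those where the seminorm is infinite.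
\<close>

definition seminorm_on :: "'a::real_vector set \<Rightarrow> ('a \<Rightarrow> real) \<Rightarrow> bool" where
  "seminorm_on D p \<longleftrightarrow> subspace D \<and>
     (\<forall>x\<in>D. 0 \<le> p x) \<and>
     (\<forall>x\<in>D. \<forall>y\<in>D. p (x + y) \<le> p x + p y) \<and>
     (\<forall>t. \<forall>x\<in>D. p (scaleR t x) = \<bar>t\<bar> * p x)"

definition lower_semicontinuous_seminorm :: "'a::real_normed_vector set \<Rightarrow> ('a \<Rightarrow> real) \<Rightarrow> bool" where
  "lower_semicontinuous_seminorm D p \<longleftrightarrow> closed {a \<in> D. p a \<le> 1}"

text \<open>The supremum is taken in the extended nonnegative reals, as it may be infinite for a general
  seminorm.\<close>

definition monge_kantorovich ::
  "'a::unital_cstar_algebra set \<Rightarrow> ('a \<Rightarrow> real) \<Rightarrow> ('a \<Rightarrow> complex) \<Rightarrow> ('a \<Rightarrow> complex) \<Rightarrow> ennreal" where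
  "monge_kantorovich D L \<phi> \<psi> = (SUP a\<in>{a \<in> D. L a \<le> 1}. ennreal (cmod (\<phi> a - \<psi> a)))"

definition metrizes :: "'b set \<Rightarrow> ('b \<Rightarrow> 'b \<Rightarrow> ennreal) \<Rightarrow> 'b topology \<Rightarrow> bool" where
  "metrizes X d T \<longleftrightarrow>
     (\<forall>x\<in>X. \<forall>y\<in>X. d x y < \<infinity>) \<and>
     Metric_space X (\<lambda>x y. enn2real (d x y)) \<and>
     Metric_space.mtopology X (\<lambda>x y. enn2real (d x y)) = T"

definition quantum_compact_metric_space ::
  "'a::unital_cstar_algebra set \<Rightarrow> ('a \<Rightarrow> real) \<Rightarrow> bool" where
  "quantum_compact_metric_space D L \<longleftrightarrow>
     D \<subseteq> self_adjoint \<and> self_adjoint \<subseteq> closure D \<and>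
     seminorm_on D L \<and>
     {a \<in> D. L a = 0} = range (\<lambda>t::real. scaleR t 1) \<and>
     metrizes state_space (monge_kantorovich D L) weak_star_topology"

end

theory Submission imports Defs begin

text \<open>
  Since the Monge-Kantorovich metric metrizes the weak* topology, the state space has finite
  diameter \<open>R\<close>. As the states determine the norm of self-adjoint elements, every \<open>a\<close> with
  \<open>L a \<le> 1\<close> lies within \<open>R + 1\<close> of the scalars. The elements with \<open>L a \<le> 1\<close> and
  \<open>norm a \<le> \<bar>R\<bar> + 1\<close> form a closed convex bounded set \<open>K\<close>; by lower semicontinuity of \<open>S\<close> and
  Baire's theorem some sublevel set of \<open>S\<close> has interior in \<open>K\<close>, so by convexity \<open>S\<close> is bounded on
  \<open>K\<close>. Neither \<open>L\<close> nor \<open>S\<close> changes under translation by scalars, so \<open>S\<close> is bounded on the unit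
  ball of \<open>L\<close>.
\<close>

section \<open>Square roots and the norm\<close>

lemma scaleC_zero: "c *\<^sub>C (0::'a::unital_cstar_algebra) = 0"
  using norm_scaleC[of c "0::'a"] by simp

lemma star_0 [simp]: "star (0::'a::unital_cstar_algebra) = 0"
  using star_add[of "0::'a" 0] by simp

lemma star_minus: "star (- x :: 'a::unital_cstar_algebra) = - star x"
  by (metis add.right_inverse add_eq_0_iff star_0 star_add)

lemma star_diff: "star (x - y :: 'a::unital_cstar_algebra) = star x - star y"
  using star_add[of x "- y"] by (simp add: star_minus)

lemma star_scaleR: "star (r *\<^sub>R x :: 'a::unital_cstar_algebra) = r *\<^sub>R star x"
  by (simp add: scaleR_eq_scaleC star_scaleC)

lemma star_1 [simp]: "star (1::'a::unital_cstar_algebra) = 1"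
  by (metis mult_1 mult_1_right star_mult star_star)

lemma star_of_real [simp]: "star (of_real r :: 'a::unital_cstar_algebra) = of_real r"
  by (simp add: of_real_def star_scaleR)

lemma star_power: "star (x ^ n :: 'a::unital_cstar_algebra) = star x ^ n"
  by (induction n) (simp_all add: star_mult power_commutes)

lemma norm_star [simp]: "norm (star x :: 'a::unital_cstar_algebra) = norm x"
proof -
  have le: "norm y \<le> norm (star y)" for y :: 'a
  proof (cases "y = 0")
    case False
    have "norm y * norm y \<le> norm (star y) * norm y"
      using norm_mult_ineq[of "star y" y] cstar_identity[of y] by (simp add: power2_eq_square)
    with False show ?thesis by simp
  qed simp
  show ?thesis using le[of x] le[of "star x"] by (simp add: star_star)
qed

lemma continuous_star: "continuous_on UNIV (star :: 'a::unital_cstar_algebra \<Rightarrow> 'a)"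
  by (rule lipschitz_on_continuous_on[of 1], rule lipschitz_onI)
     (simp_all add: dist_norm flip: star_diff)

lemma norm_square_self_adjoint:
  fixes a :: "'a::unital_cstar_algebra"
  assumes "star a = a"
  shows "norm (a * a) = (norm a)\<^sup>2"
  using cstar_identity[of a] assms by simp

lemma scaleC_ii: "\<i> *\<^sub>C \<i> *\<^sub>C x = - (x::'a::unital_cstar_algebra)"
  using scaleR_eq_scaleC[of "-1" x] by (simp add: scaleC_scaleC)

lemma scaleC_minus_right: "c *\<^sub>C (- x) = - (c *\<^sub>C (x::'a::unital_cstar_algebra))"
  by (metis add.right_inverse add_eq_0_iff scaleC_zero scaleC_add_right)

lemma scaleC_diff_right: "c *\<^sub>C (x - y) = c *\<^sub>C x - c *\<^sub>C (y::'a::unital_cstar_algebra)"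
  using scaleC_add_right[of c x "- y"] by (simp add: scaleC_minus_right)

lemma scaleC_uminus_left: "(- c) *\<^sub>C x = - (c *\<^sub>C (x::'a::unital_cstar_algebra))"
  by (metis mult_minus1 scaleC_scaleC scaleR_eq_scaleC of_real_1 of_real_minus scaleR_minus1_left)

text \<open>With \<open>b = 1 - c\<close> the equation \<open>b * b = 1 - h\<close> becomes
  \<open>c = (h + c * c) / 2\<close>, which Banach's fixed point theorem solves. The commutation
  clause serves to make two such roots commute later.\<close>

lemma sqrt_one_minus:
  fixes h :: "'a::unital_cstar_algebra"
  assumes h: "star h = h" and lt: "norm h < 1"
  obtains b where "star b = b" "b * b = 1 - h" "\<And>z. z * h = h * z \<Longrightarrow> z * b = b * z"
proof -
  \<comment> \<open>\<open>\<rho>\<close> is the smaller root of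
    \<open>norm h + \<rho>^2 = 2 * \<rho>\<close>: the ball of this radius is mapped into itself by
    \<open>T\<close>, and \<open>\<rho> < 1\<close> is the contraction constant there.\<close>
  define \<rho> where "\<rho> = 1 - sqrt (1 - norm h)"
  have s: "0 < sqrt (1 - norm h)" "sqrt (1 - norm h) \<le> 1" using lt by simp_all
  have \<rho>: "0 \<le> \<rho>" "\<rho> < 1" using s by (simp_all add: \<rho>_def)
  have "(sqrt (1 - norm h))\<^sup>2 = 1 - norm h" using lt by simp
  then have \<rho>eq: "norm h + \<rho>\<^sup>2 = 2 * \<rho>" by (simp add: \<rho>_def power2_eq_square algebra_simps)
  \<comment> \<open>Self-adjointness and the commutation property are closed conditions preserved by
    \<open>T\<close>; building them into \<open>K\<close> hands them to the fixed point.\<close>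
  define K where "K = {c. star c = c} \<inter> cball 0 \<rho> \<inter> (\<Inter>z\<in>{z. z * h = h * z}. {c. z * c = c * z})"
  define T where "T = (\<lambda>c. (1/2) *\<^sub>R (h + c * c))"
  have "closed K" unfolding K_def
    by (intro closed_Int closed_INT ballI closed_cball closed_Collect_eq continuous_intros continuous_star)
  then have "complete K" by (simp add: complete_eq_closed)
  moreover have "0 \<in> K" using \<rho> by (simp add: K_def)
  moreover have "T ` K \<subseteq> K"
  proof clarify
    fix c assume c: "c \<in> K"
    then have n: "norm c \<le> \<rho>" and sc: "star c = c" by (auto simp: K_def)
    have "norm (h + c * c) \<le> norm h + norm c * norm c"
      by (meson add_left_mono norm_mult_ineq norm_triangle_le)
    also have "\<dots> \<le> norm h + \<rho> * \<rho>" using n \<rho> by (intro add_left_mono mult_mono) auto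
    finally have "norm (T c) \<le> \<rho>" using \<rho>eq by (simp add: T_def power2_eq_square)
    moreover have "z * T c = T c * z" if "z * h = h * z" for z
    proof -
      have "z * c = c * z" using c that unfolding K_def by blast
      then have "z * (c * c) = (c * c) * z" by (metis mult.assoc)
      then show ?thesis using that by (simp add: T_def algebra_simps)
    qed
    moreover have "star (T c) = T c"
      using sc h by (simp add: T_def star_scaleR star_add star_mult)
    ultimately show "T c \<in> K" unfolding K_def by auto
  qed
  moreover have "dist (T c) (T d) \<le> \<rho> * dist c d" if "c \<in> K" "d \<in> K" for c d
  proof -
    have n: "norm c \<le> \<rho>" "norm d \<le> \<rho>" using that by (auto simp: K_def)
    have "T c - T d = (1/2) *\<^sub>R (c * (c - d) + (c - d) * d)"
      unfolding T_def scaleR_diff_right[symmetric] by (simp add: algebra_simps)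
    then have "norm (T c - T d) = (1/2) * norm (c * (c - d) + (c - d) * d)" by simp
    also have "\<dots> \<le> (1/2) * (norm c * norm (c - d) + norm (c - d) * norm d)"
      by (intro mult_left_mono norm_triangle_le add_mono norm_mult_ineq) auto
    also have "\<dots> \<le> (1/2) * (\<rho> * norm (c - d) + norm (c - d) * \<rho>)"
      using n by (intro mult_left_mono add_mono mult_right_mono) auto
    finally show ?thesis by (simp add: dist_norm)
  qed
  ultimately have "\<exists>!c\<in>K. T c = c"
    using \<rho> by (intro Banach_fix[of K \<rho> T]) auto
  then obtain c where c: "c \<in> K" "T c = c" by blast
  have "c + c = h + c * c"
    by (metis c(2) T_def scaleR_half_double scaleR_right_distrib)
  then have "(1 - c) * (1 - c) = 1 - h" by (simp add: algebra_simps)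
  moreover have "star (1 - c) = 1 - c" using c(1) by (auto simp: K_def star_diff)
  moreover have "z * (1 - c) = (1 - c) * z" if "z * h = h * z" for z
  proof -
    have "z * c = c * z" using c(1) that unfolding K_def by blast
    then show ?thesis by (simp add: algebra_simps)
  qed
  ultimately show ?thesis using that by blast
qed

text \<open>For \<open>u = b + i a\<close>, commutation gives
  \<open>star u * u = a * a + b * b\<close>, and the self-adjoint part \<open>b\<close> of
  \<open>u\<close> has norm at most \<open>norm u\<close>.\<close>

lemma norm_square_le_add_square:
  fixes a b :: "'a::unital_cstar_algebra"
  assumes a: "star a = a" and b: "star b = b" and ab: "a * b = b * a"
  shows "(norm b)\<^sup>2 \<le> norm (a * a + b * b)"
proof -
  define u where "u = b + \<i> *\<^sub>C a"
  have su: "star u = b - \<i> *\<^sub>C a"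
    by (simp add: u_def star_add star_scaleC a b scaleC_uminus_left)
  have "(norm u)\<^sup>2 = norm (star u * u)" by (simp add: cstar_identity)
  also have "star u * u = a * a + b * b"
    unfolding su unfolding u_def
    by (simp add: algebra_simps mult_scaleC_left mult_scaleC_right scaleC_ii scaleC_diff_right scaleC_add_right ab)
  finally have u: "(norm u)\<^sup>2 = norm (a * a + b * b)" .
  have "2 *\<^sub>R b = u + star u" unfolding su unfolding u_def by (simp add: scaleR_2)
  then have "norm (2 *\<^sub>R b) \<le> norm u + norm (star u)" by (metis norm_triangle_ineq)
  then have "norm b \<le> norm u" by simp
  then show ?thesis using u by (metis norm_ge_zero power_mono)
qed

section \<open>Positive elements\<close>

text \<open>For self-adjoint \<open>a\<close> the norm condition holds for some \<open>t\<close> iff the spectrum of \<open>a\<close> is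
  nonnegative; \<open>t\<close> is automatically nonnegative.\<close>

definition cstar_positive :: "'a::unital_cstar_algebra \<Rightarrow> bool" where
  "cstar_positive a \<longleftrightarrow> star a = a \<and> (\<exists>t. norm (of_real t - a) \<le> t)"

lemma cstar_positiveI: "star a = a \<Longrightarrow> norm (of_real t - a) \<le> t \<Longrightarrow> cstar_positive a"
  by (auto simp: cstar_positive_def)

lemma cstar_positive_star: "cstar_positive a \<Longrightarrow> star a = a"
  by (simp add: cstar_positive_def)

text \<open>In this norm form of positivity, closure under sums is the triangle inequality: centres
  and radii add.\<close>

lemma cstar_positive_add:
  assumes "cstar_positive a" "cstar_positive b"
  shows "cstar_positive (a + b)"
proof -
  obtain s t where st: "norm (of_real s - a) \<le> s" "norm (of_real t - b) \<le> t"
    using assms by (auto simp: cstar_positive_def)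
  have "norm (of_real (s + t) - (a + b)) = norm ((of_real s - a) + (of_real t - b))"
    by (simp add: algebra_simps)
  also have "\<dots> \<le> s + t" using st by (intro norm_triangle_le) linarith
  finally show ?thesis
    using assms by (intro cstar_positiveI[of _ "s + t"]) (simp_all add: star_add cstar_positive_star)
qed

lemma cstar_positive_scaleR:
  assumes "cstar_positive a" "0 \<le> r"
  shows "cstar_positive (r *\<^sub>R a)"
proof -
  obtain t where t: "norm (of_real t - a) \<le> t"
    using assms by (auto simp: cstar_positive_def)
  have "norm (of_real (r * t) - r *\<^sub>R a) = norm (r *\<^sub>R (of_real t - a))"
    by (simp add: algebra_simps scaleR_conv_of_real)
  also have "\<dots> \<le> r * t" using t assms(2) by (simp add: mult_left_mono)
  finally show ?thesis
    using assms by (intro cstar_positiveI[of _ "r * t"]) (simp_all add: star_scaleR cstar_positive_star)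
qed

text \<open>The shift by \<open>\<epsilon>\<close> allows division by \<open>t + \<epsilon>\<close>
  instead of \<open>t\<close>, so that \<open>norm k < 1\<close> holds strictly and
  \<open>1 - k\<close> has a square root.\<close>

lemma cstar_positive_square_approx:
  assumes "cstar_positive a" "0 < \<epsilon>"
  obtains b where "star b = b" "b * b = a + of_real \<epsilon>" "\<And>z. z * a = a * z \<Longrightarrow> z * b = b * z"
proof -
  obtain t where t: "norm (of_real t - a) \<le> t"
    using assms by (auto simp: cstar_positive_def)
  then have t0: "0 \<le> t" using norm_ge_zero order_trans by blast
  define k where "k = (1 / (t + \<epsilon>)) *\<^sub>R (of_real t - a)"
  have sk: "star k = k" using assms(1) by (simp add: k_def star_scaleR star_diff cstar_positive_star)
  have "norm k = norm (of_real t - a) / (t + \<epsilon>)" using t0 assms(2) by (simp add: k_def)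
  then have "norm k < 1" using t t0 assms(2) by (simp add: divide_less_eq)
  then obtain c where c: "star c = c" "c * c = 1 - k" "\<And>z. z * k = k * z \<Longrightarrow> z * c = c * z"
    using sqrt_one_minus[OF sk] by blast
  define b where "b = sqrt (t + \<epsilon>) *\<^sub>R c"
  have "b * b = (t + \<epsilon>) *\<^sub>R (1 - k)" using t0 assms(2) by (simp add: b_def c)
  also have "\<dots> = (t + \<epsilon>) *\<^sub>R 1 - (of_real t - a)"
    using t0 assms(2) unfolding k_def by (simp add: scaleR_diff_right)
  also have "\<dots> = a + of_real \<epsilon>" by (simp add: of_real_def algebra_simps)
  finally have "b * b = a + of_real \<epsilon>" .
  moreover have "star b = b" by (simp add: b_def star_scaleR c)
  moreover have "z * b = b * z" if "z * a = a * z" for z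
  proof -
    have "z * k = k * z"
      using that by (simp add: k_def right_diff_distrib left_diff_distrib of_real_def)
    then have "z * c = c * z" by (rule c(3))
    then show ?thesis by (simp add: b_def)
  qed
  ultimately show ?thesis using that by blast
qed

text \<open>Up to \<open>\<epsilon>\<close>, both \<open>a\<close> and \<open>of_real c - a\<close>
  are squares of commuting self-adjoint elements \<open>b\<close> and \<open>d\<close>, so
  \<open>(norm b)^2\<close> is at most the norm of the scalar \<open>d * d + b * b\<close>.\<close>

lemma norm_le_of_cstar_positive:
  assumes a: "cstar_positive a" and ca: "cstar_positive (of_real c - a)"
  shows "norm a \<le> c"
proof -
  have "cstar_positive (of_real c :: 'a)" using cstar_positive_add[OF a ca] by simp
  then obtain t where "norm (of_real t - of_real c :: 'a) \<le> t" by (auto simp: cstar_positive_def)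
  \<comment> \<open>The ball of radius \<open>t\<close> around \<open>t\<close> contains no negative
    scalar. The sign is used to evaluate the norm of the scalar below.\<close>
  then have c0: "0 \<le> c"
    by (smt (verit) norm_of_real of_real_diff)
  have "norm a \<le> c + e" if e: "0 < e" for e
  proof -
    \<comment> \<open>Two thirds of \<open>e\<close> pay for the two approximate squares, one third
      for removing the shift from \<open>a + of_real \<epsilon>\<close>.\<close>
    define \<epsilon> where "\<epsilon> = e / 3"
    have \<epsilon>: "0 < \<epsilon>" using e by (simp add: \<epsilon>_def)
    obtain b where b: "star b = b" "b * b = a + of_real \<epsilon>" "\<And>z. z * a = a * z \<Longrightarrow> z * b = b * z"
      using cstar_positive_square_approx[OF a \<epsilon>] by metis
    obtain d where d: "star d = d" "d * d = of_real c - a + of_real \<epsilon>"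
      "\<And>z. z * (of_real c - a) = (of_real c - a) * z \<Longrightarrow> z * d = d * z"
      using cstar_positive_square_approx[OF ca \<epsilon>] by metis
    \<comment> \<open>\<open>b\<close> commutes with \<open>a\<close>, hence with
      \<open>of_real c - a\<close>, hence with \<open>d\<close>.\<close>
    have "b * a = a * b" using b(3)[of a] by simp
    then have "b * (of_real c - a) = (of_real c - a) * b"
      by (simp add: right_diff_distrib left_diff_distrib of_real_def)
    then have "b * d = d * b" by (rule d(3))
    then have "(norm b)\<^sup>2 \<le> norm (d * d + b * b)"
      using norm_square_le_add_square[OF d(1) b(1)] by simp
    also have "d * d + b * b = of_real (c + \<epsilon> + \<epsilon>)"
      by (simp add: b d) (rule mult_2[symmetric])
    also have "norm \<dots> = c + \<epsilon> + \<epsilon>" using c0 \<epsilon> by (simp only: norm_of_real)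
    finally have "norm (a + of_real \<epsilon>) \<le> c + \<epsilon> + \<epsilon>"
      using norm_square_self_adjoint[OF b(1)] b(2) by simp
    moreover have "norm a \<le> norm (a + of_real \<epsilon>) + norm (of_real \<epsilon> :: 'a)"
      using norm_triangle_ineq4[of "a + of_real \<epsilon>" "of_real \<epsilon>"] by simp
    ultimately show ?thesis using \<epsilon> by (simp add: \<epsilon>_def)
  qed
  then show ?thesis by (rule field_le_epsilon)
qed

text \<open>After scaling to \<open>norm c < 1\<close>, the complement \<open>1 - c * c\<close> is a
  square \<open>d * d\<close> with \<open>d\<close> commuting with \<open>c\<close>; since
  \<open>c * c + d * d = 1\<close>, its norm is at most 1, so \<open>t = 1\<close> witnesses
  positivity.\<close>

lemma cstar_positive_square:
  assumes "star a = a"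
  shows "cstar_positive (a * a)"
proof -
  define s where "s = norm a + 1"
  have s: "0 < s" by (simp add: s_def add_nonneg_pos)
  define c where "c = (1 / s) *\<^sub>R a"
  have sc: "star c = c" by (simp add: c_def star_scaleR assms)
  have "norm c < 1" using s by (simp add: c_def s_def)
  then have "norm (c * c) < 1"
    using norm_square_self_adjoint[OF sc] by (simp add: power_less_one_iff)
  moreover have scc: "star (c * c) = c * c" by (simp add: star_mult sc)
  ultimately obtain d where d: "star d = d" "d * d = 1 - c * c"
    "\<And>z. z * (c * c) = (c * c) * z \<Longrightarrow> z * d = d * z"
    using sqrt_one_minus[of "c * c"] by metis
  have "c * d = d * c" by (rule d(3)) (simp add: mult.assoc)
  then have "(norm d)\<^sup>2 \<le> norm (c * c + d * d)" by (rule norm_square_le_add_square[OF sc d(1)])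
  then have "norm (of_real 1 - c * c) \<le> 1"
    using norm_square_self_adjoint[OF d(1)] by (simp add: d(2))
  then have "cstar_positive (c * c)" using scc by (intro cstar_positiveI)
  then have "cstar_positive ((s * s) *\<^sub>R (c * c))" using s by (intro cstar_positive_scaleR) auto
  then show ?thesis using s by (simp add: c_def)
qed

section \<open>Positivity of \<open>star x * x\<close>\<close>

text \<open>Twice this element is \<open>a * a + b * b\<close> for the self-adjoint elements
  \<open>a = y + star y\<close> and \<open>b = i (y - star y)\<close>: the mixed squares of
  \<open>y\<close> and \<open>star y\<close> cancel.\<close>

lemma cstar_positive_mult_star_add:
  "cstar_positive (star y * y + y * star y)"
proof -
  define a where "a = y + star y"
  define b where "b = \<i> *\<^sub>C (y - star y)"
  have "star a = a" by (simp add: a_def star_add star_star add.commute)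
  moreover have "star b = b"
    by (simp add: b_def star_scaleC star_diff star_star scaleC_uminus_left scaleC_diff_right)
  ultimately have "cstar_positive (a * a + b * b)"
    by (intro cstar_positive_add cstar_positive_square)
  moreover have "b * b = - ((y - star y) * (y - star y))"
    by (simp add: b_def mult_scaleC_left mult_scaleC_right scaleC_ii)
  then have "a * a + b * b = 2 *\<^sub>R (star y * y + y * star y)"
    by (simp add: a_def algebra_simps scaleR_2)
  ultimately have "cstar_positive ((1/2) *\<^sub>R (2 *\<^sub>R (star y * y + y * star y)))"
    by (metis cstar_positive_scaleR divide_nonneg_nonneg zero_le_one zero_le_numeral)
  then show ?thesis by simp
qed

text \<open>Exponential growth beats linear growth. Only exponents \<open>2 ^ m\<close> occur
  because for these the norm of a power of a self-adjoint element is the power of its norm.\<close>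

lemma le_one_if_power_bound:
  fixes q :: real
  assumes "\<And>m. q ^ (2 ^ m) \<le> 2 ^ m + 1" and "0 \<le> q"
  shows "q \<le> 1"
proof (rule ccontr)
  assume "\<not> q \<le> 1"
  define \<delta> where "\<delta> = q - 1"
  have \<delta>: "0 < \<delta>" using \<open>\<not> q \<le> 1\<close> by (simp add: \<delta>_def)
  \<comment> \<open>Chosen so that \<open>N * \<delta>^2 > 2\<close> for \<open>N = 2 ^ m\<close>,
    against the bound derived at the end.\<close>
  obtain m where m: "2 / \<delta>\<^sup>2 < 2 ^ m" using real_arch_pow[of 2 "2 / \<delta>\<^sup>2"] by auto
  define N :: real where "N = 2 ^ m"
  have "1 + real (2 ^ m) * \<delta> \<le> (1 + \<delta>) ^ (2 ^ m)"
    using \<delta> by (intro Bernoulli_inequality) auto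
  then have "1 + N * \<delta> \<le> q ^ (2 ^ m)" by (simp add: N_def \<delta>_def)
  \<comment> \<open>Bernoulli's bound is only linear in \<open>N\<close>; squaring it makes it
    quadratic, while the assumption at \<open>Suc m\<close> stays linear.\<close>
  then have "(1 + N * \<delta>)\<^sup>2 \<le> (q ^ (2 ^ m))\<^sup>2" using \<delta> by (intro power_mono) (auto simp: N_def)
  also have "\<dots> = q ^ (2 ^ Suc m)" by (simp flip: power_mult add: mult.commute)
  also have "\<dots> \<le> 2 * N + 1" using assms(1)[of "Suc m"] by (simp add: N_def)
  finally have "N * (N * \<delta>\<^sup>2) + 2 * (N * \<delta>) \<le> N * 2" by (simp add: power2_eq_square algebra_simps)
  moreover have "0 < N * \<delta>" "0 < N" using \<delta> by (auto simp: N_def)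
  ultimately have "N * (N * \<delta>\<^sup>2) < N * 2" by linarith
  then have "N * \<delta>\<^sup>2 < 2" using \<open>0 < N\<close> by simp
  then show False using m \<delta> by (simp add: N_def divide_less_eq)
qed

text \<open>Repeated squaring: each step is the C*-identity for the self-adjoint element
  \<open>g ^ (2 ^ m)\<close>.\<close>

lemma norm_power_two_power:
  fixes g :: "'a::unital_cstar_algebra"
  assumes "star g = g"
  shows "norm (g ^ (2 ^ m)) = norm g ^ (2 ^ m)"
proof (induction m)
  case (Suc m)
  have "star (g ^ (2 ^ m)) = g ^ (2 ^ m)" by (simp add: star_power assms)
  from norm_square_self_adjoint[OF this] Suc show ?case
    by (simp add: mult_2 power_add power2_eq_square)
qed simp

text \<open>
  With \<open>w = star x * x\<close>, \<open>h = x * star x\<close> and \<open>y = x * r ^ n\<close>, where \<open>r\<close> is the square root of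
  \<open>1 - w\<close>, positivity of \<open>star y * y + y * star y\<close> reads \<open>w (1 - w)^n + h (1 - h)^n \<ge> 0\<close>. Since
  \<open>h (1 - h)^n\<close> decreases in \<open>n\<close>, it is at most 1, so \<open>(1 - w)^(n + 1) \<le> (1 - w)^n + 1\<close>. Thus the
  powers of \<open>1 - w\<close> grow at most linearly, which forces \<open>norm (1 - w) \<le> 1\<close>.
\<close>

lemma cstar_positive_star_mult_self_contraction:
  assumes "norm x < 1"
  shows "cstar_positive (star x * x)"
proof -
  define h where "h = x * star x"
  define w where "w = star x * x"
  have sh: "star h = h" and sw: "star w = w" by (simp_all add: h_def w_def star_mult star_star)
  have "norm w = (norm x)\<^sup>2" by (simp add: w_def cstar_identity)
  then have nw: "norm w < 1" using assms by (simp add: power_less_one_iff)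
  have "norm h = (norm x)\<^sup>2" using cstar_identity[of "star x"] by (simp add: h_def star_star)
  then have nh: "norm h < 1" using assms by (simp add: power_less_one_iff)
  obtain v where v: "star v = v" "v * v = 1 - h" "\<And>z. z * h = h * z \<Longrightarrow> z * v = v * z"
    using sqrt_one_minus[OF sh nh] by blast
  obtain r where r: "star r = r" "r * r = 1 - w" "\<And>z. z * w = w * z \<Longrightarrow> z * r = r * z"
    using sqrt_one_minus[OF sw nw] by blast
  have sq: "z ^ n * z ^ n = (z * z) ^ n" for z :: 'a and n
    by (metis mult_2 power2_eq_square power_add power_mult)
  have vn: "v ^ n * v ^ n = (1 - h) ^ n" and rn: "r ^ n * r ^ n = (1 - w) ^ n" for n
    by (simp_all only: sq v(2) r(2))
  have hv: "v ^ n * h = h * v ^ n" for n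
    using v(3)[of h] by (simp add: power_commuting_commutes)
  have wr: "r ^ n * w = w * r ^ n" for n
    using r(3)[of w] by (simp add: power_commuting_commutes)
  \<comment> \<open>\<open>x\<close> intertwines \<open>w\<close> and \<open>h\<close>, which turns
    \<open>y * star y\<close> into an expression in \<open>h\<close> alone.\<close>
  have xw: "x * (1 - w) ^ n = (1 - h) ^ n * x" for n
  proof (induction n)
    case (Suc n)
    have "x * (1 - w) = (1 - h) * x" by (simp add: h_def w_def algebra_simps)
    then show ?case using Suc by (metis mult.assoc power_Suc)
  qed simp
  have sum_pos: "cstar_positive (w * (1 - w) ^ n + h * (1 - h) ^ n)" for n
  proof -
    define y where "y = x * r ^ n"
    have sy: "star y = r ^ n * star x" by (simp add: y_def star_mult star_power r(1))
    have "star y * y = w * (1 - w) ^ n"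
      unfolding sy unfolding y_def rn[symmetric]
      by (metis mult.assoc w_def wr)
    moreover have "y * star y = x * (1 - w) ^ n * star x"
      unfolding sy unfolding y_def rn[symmetric] by (simp add: mult.assoc)
    then have "y * star y = (1 - h) ^ n * h" by (simp add: xw h_def mult.assoc)
    then have "y * star y = h * (1 - h) ^ n" by (metis hv mult.assoc vn)
    ultimately show ?thesis using cstar_positive_mult_star_add[of y] by simp
  qed
  \<comment> \<open>The terms start at \<open>1 - h = v * v\<close>, and consecutive ones differ by
    \<open>h * (1 - h) ^ n * h\<close>, the square of the self-adjoint
    \<open>h * v ^ n\<close>.\<close>
  have h_le: "cstar_positive (1 - h * (1 - h) ^ n)" for n
  proof (induction n)
    case 0
    show ?case using cstar_positive_square[OF v(1)] by (simp add: v(2))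
  next
    case (Suc n)
    define k where "k = h * v ^ n"
    have "star k = k" by (simp add: k_def star_mult star_power v(1) sh hv)
    moreover have "k * k = h * (1 - h) ^ n * h"
      unfolding k_def vn[symmetric] by (metis hv mult.assoc)
    then have eq: "1 - h * (1 - h) ^ Suc n = (1 - h * (1 - h) ^ n) + k * k"
      by (simp only: power_Suc2) (simp add: algebra_simps)
    ultimately show ?case unfolding eq using Suc by (intro cstar_positive_add cstar_positive_square)
  qed
  have w_ge: "cstar_positive (1 + w * (1 - w) ^ n)" for n
    using cstar_positive_add[OF h_le[of n] sum_pos[of n]] by (simp add: algebra_simps)
  have g_le: "cstar_positive (of_real (real n + 1) - (1 - w) ^ n)" for n
  proof (induction n)
    case 0
    show ?case using cstar_positiveI[of 0 0] by simp
  next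
    case (Suc n)
    have "of_real (real (Suc n) + 1) - (1 - w) ^ Suc n =
        (of_real (real n + 1) - (1 - w) ^ n) + (1 + w * (1 - w) ^ n)"
      by (simp add: algebra_simps)
    then show ?case using cstar_positive_add[OF Suc w_ge[of n]] by metis
  qed
  have g_pos: "cstar_positive ((1 - w) ^ n)" for n
    using cstar_positive_square[of "r ^ n"] by (simp add: star_power r(1) rn)
  \<comment> \<open>The positive element \<open>(1 - w) ^ n\<close> is bounded by the scalar
    \<open>n + 1\<close>, hence so is its norm; \<open>n = 2 ^ m\<close> converts this into a power
    of \<open>norm (1 - w)\<close>.\<close>
  have "norm (1 - w) ^ (2 ^ m) \<le> 2 ^ m + 1" for m
    using norm_le_of_cstar_positive[OF g_pos g_le, of "2 ^ m"]
    by (simp add: norm_power_two_power star_diff sw)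
  then have "norm (1 - w) \<le> 1" by (rule le_one_if_power_bound) simp
  then show ?thesis using cstar_positiveI[OF sw, of 1] by (simp add: w_def)
qed

lemma cstar_positive_star_mult_self: "cstar_positive (star x * x)"
proof -
  define s where "s = norm x + 1"
  have s: "0 < s" by (simp add: s_def add_nonneg_pos)
  have "cstar_positive (star ((1 / s) *\<^sub>R x) * ((1 / s) *\<^sub>R x))"
    using s by (intro cstar_positive_star_mult_self_contraction) (simp add: s_def)
  then have "cstar_positive ((s * s) *\<^sub>R (star ((1 / s) *\<^sub>R x) * ((1 / s) *\<^sub>R x)))"
    using s by (intro cstar_positive_scaleR) auto
  then show ?thesis using s by (simp add: star_scaleR)
qed

section \<open>The Hahn-Banach theorem\<close>

definition sublinear :: "('a::real_vector \<Rightarrow> real) \<Rightarrow> bool" where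
  "sublinear p \<longleftrightarrow> (\<forall>x y. p (x + y) \<le> p x + p y) \<and> (\<forall>t x. 0 \<le> t \<longrightarrow> p (t *\<^sub>R x) = t * p x)"

lemma sublinear_add: "sublinear p \<Longrightarrow> p (x + y) \<le> p x + p y"
  and sublinear_scaleR: "sublinear p \<Longrightarrow> 0 \<le> t \<Longrightarrow> p (t *\<^sub>R x) = t * p x"
  by (auto simp: sublinear_def)

lemma sublinear_0: "sublinear p \<Longrightarrow> p 0 = 0"
  using sublinear_scaleR[of p 0 0] by simp

lemma sublinear_ge: "sublinear p \<Longrightarrow> - p (- x) \<le> p x"
  using sublinear_add[of p x "- x"] sublinear_0[of p] by simp

text \<open>The witness is \<open>q x = inf {p (x + t y) - t (p y) | t \<ge> 0}\<close>.\<close>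

lemma sublinear_tilt:
  assumes p: "sublinear p"
  obtains q where "sublinear q" "\<And>x. q x \<le> p x" "q (- y) \<le> - p y"
proof -
  define S where "S x = (\<lambda>t. p (x + t *\<^sub>R y) - t * p y) ` {0..}" for x
  define q where "q x = Inf (S x)" for x
  \<comment> \<open>Subadditivity gives
    \<open>t * p y \<le> p (x + t *\<^sub>R y) + p (- x)\<close>. The bound is independent of
    \<open>t\<close>, so the infimum is finite.\<close>
  have lb: "- p (- x) \<le> z" if z: "z \<in> S x" for x z
  proof -
    obtain t where t: "0 \<le> t" "z = p (x + t *\<^sub>R y) - t * p y" using z by (auto simp: S_def)
    show ?thesis
      using sublinear_add[OF p, of "x + t *\<^sub>R y" "- x"] sublinear_scaleR[OF p t(1), of y] t(2) by simp
  qed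
  then have bdd: "bdd_below (S x)" for x by (meson bdd_belowI)
  have ne: "S x \<noteq> {}" for x by (auto simp: S_def)
  have q_le: "q x \<le> p (x + t *\<^sub>R y) - t * p y" if "0 \<le> t" for x t
    unfolding q_def using that by (intro cInf_lower bdd) (auto simp: S_def)
  have le_q: "c \<le> q x" if "\<And>t. 0 \<le> t \<Longrightarrow> c \<le> p (x + t *\<^sub>R y) - t * p y" for c x
    unfolding q_def using that by (intro cInf_greatest ne) (auto simp: S_def)
  have "q (x + z) \<le> q x + q z" for x z
  proof -
    have "q (x + z) - (p (z + s *\<^sub>R y) - s * p y) \<le> q x" if "0 \<le> s" for s
    proof (rule le_q)
      fix t :: real assume "0 \<le> t"
      show "q (x + z) - (p (z + s *\<^sub>R y) - s * p y) \<le> p (x + t *\<^sub>R y) - t * p y"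
        using q_le[of "t + s" "x + z"] sublinear_add[OF p, of "x + t *\<^sub>R y" "z + s *\<^sub>R y"]
          \<open>0 \<le> t\<close> \<open>0 \<le> s\<close> by (simp add: algebra_simps)
    qed
    then have "q (x + z) - q x \<le> q z" by (intro le_q) (simp add: algebra_simps)
    then show ?thesis by simp
  qed
  moreover have "q (t *\<^sub>R x) = t * q x" if "0 \<le> t" for t x
  proof (cases "t = 0")
    case True
    have "q 0 \<le> 0" using q_le[of 0 0] by (simp add: sublinear_0[OF p])
    moreover have "0 \<le> q 0" by (rule le_q) (simp add: sublinear_scaleR[OF p])
    ultimately show ?thesis using True by simp
  next
    case False
    then have t: "0 < t" using that by simp
    \<comment> \<open>One inequality for all positive scalars suffices: applied to
      \<open>1 / t\<close> it gives the reverse one.\<close>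
    have le: "q (s *\<^sub>R z) \<le> s * q z" if s: "0 < s" for s z
    proof -
      have "q (s *\<^sub>R z) / s \<le> q z"
      proof (rule le_q)
        fix r :: real assume r: "0 \<le> r"
        have "q (s *\<^sub>R z) \<le> p (s *\<^sub>R (z + r *\<^sub>R y)) - (s * r) * p y"
          using q_le[of "s * r" "s *\<^sub>R z"] r s by (simp add: scaleR_add_right)
        also have "\<dots> = s * (p (z + r *\<^sub>R y) - r * p y)"
          using s sublinear_scaleR[OF p, of s "z + r *\<^sub>R y"] by (simp add: right_diff_distrib)
        finally show "q (s *\<^sub>R z) / s \<le> p (z + r *\<^sub>R y) - r * p y"
          using s by (simp add: divide_le_eq mult.commute)
      qed
      then show ?thesis using s by (simp add: divide_le_eq mult.commute)
    qed
    have "q x \<le> (1 / t) * q (t *\<^sub>R x)" using le[of "1 / t" "t *\<^sub>R x"] t by simp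
    then have "t * q x \<le> q (t *\<^sub>R x)" using t by (simp add: le_divide_eq mult.commute)
    with le[OF t, of x] show ?thesis by simp
  qed
  ultimately have "sublinear q" by (auto simp: sublinear_def)
  moreover have "q x \<le> p x" for x using q_le[of 0 x] by simp
  moreover have "q (- y) \<le> - p y" using q_le[of 1 "- y"] by (simp add: sublinear_0[OF p])
  ultimately show ?thesis using that by blast
qed

text \<open>Zorn's lemma for the sublinear functionals below \<open>p\<close>; a nonempty chain is
  bounded by its pointwise infimum.\<close>

lemma minimal_sublinear_exists:
  assumes p: "sublinear p"
  obtains f where "sublinear f" "\<And>x. f x \<le> p x"
    "\<And>q. sublinear q \<Longrightarrow> (\<And>x. q x \<le> f x) \<Longrightarrow> q = f"
proof -
  define A where "A = {q. sublinear q \<and> (\<forall>x. q x \<le> p x)}"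
  \<comment> \<open>The pointwise order is reversed, so that a maximal element for Zorn's lemma is a
    minimal functional.\<close>
  define P where "P = (\<lambda>f g :: 'a \<Rightarrow> real. \<forall>x. g x \<le> f x)"
  have "\<exists>m\<in>A. \<forall>a\<in>A. P m a \<longrightarrow> a = m"
  proof (rule predicate_Zorn)
    show "partial_order_on A (relation_of P A)"
      by (rule partial_order_on_relation_ofI) (auto simp: P_def fun_eq_iff intro: order_trans antisym)
  next
    fix C assume C: "C \<in> Chains (relation_of P A)"
    then have CA: "C \<subseteq> A" and tot: "\<And>f g. f \<in> C \<Longrightarrow> g \<in> C \<Longrightarrow> P f g \<or> P g f"
      by (auto simp: Chains_def relation_of_def)
    show "\<exists>u\<in>A. \<forall>a\<in>C. P a u"
    proof (cases "C = {}")
      case True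
      then show ?thesis using p by (auto simp: A_def)
    next
      case False
      define u where "u x = (INF f\<in>C. f x)" for x
      have sub: "sublinear f" and fp: "f x \<le> p x" if "f \<in> C" for f x
        using that CA by (auto simp: A_def)
      have bdd: "bdd_below ((\<lambda>f. f x) ` C)" for x
      proof (rule bdd_belowI2)
        fix f assume f: "f \<in> C"
        show "- p (- x) \<le> f x" using sublinear_ge[OF sub[OF f], of x] fp[OF f, of "- x"] by linarith
      qed
      have u_le: "u x \<le> f x" if "f \<in> C" for f x
        unfolding u_def using bdd that by (rule cINF_lower)
      have le_u: "c \<le> u x" if "\<And>f. f \<in> C \<Longrightarrow> c \<le> f x" for c x
        unfolding u_def using False that by (rule cINF_greatest)
      have "u (x + y) \<le> u x + u y" for x y
      proof -
        \<comment> \<open>Two members of the chain are comparable, so both can be replaced by the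
          smaller one, which is subadditive.\<close>
        have "u (x + y) \<le> f x + g y" if f: "f \<in> C" and g: "g \<in> C" for f g
        proof -
          from tot[OF f g] consider "\<And>z. f z \<le> g z" | "\<And>z. g z \<le> f z" by (auto simp: P_def)
          then show ?thesis
          proof cases
            case 1
            then show ?thesis
              using u_le[OF f, of "x + y"] sublinear_add[OF sub[OF f], of x y] by (smt (verit))
          next
            case 2
            then show ?thesis
              using u_le[OF g, of "x + y"] sublinear_add[OF sub[OF g], of x y] by (smt (verit))
          qed
        qed
        then have "u (x + y) - g y \<le> u x" if "g \<in> C" for g
          using that by (intro le_u) (simp add: algebra_simps)
        then have "u (x + y) - u x \<le> u y" by (intro le_u) (simp add: algebra_simps)
        then show ?thesis by simp
      qed
      moreover have "u (t *\<^sub>R x) = t * u x" if t: "0 \<le> t" for t x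
      proof (cases "t = 0")
        case True
        have "(\<lambda>f. f (0::'a)) ` C = {0}" using False by (auto simp: sublinear_0 sub)
        then show ?thesis using True by (simp add: u_def)
      next
        case nz: False
        then have t': "0 < t" using t by simp
        have "u (t *\<^sub>R x) / t \<le> u x"
        proof (rule le_u)
          fix f assume f: "f \<in> C"
          show "u (t *\<^sub>R x) / t \<le> f x"
            using u_le[OF f, of "t *\<^sub>R x"] sublinear_scaleR[OF sub[OF f] t, of x] t'
            by (simp add: divide_le_eq mult.commute)
        qed
        moreover have "t * u x \<le> u (t *\<^sub>R x)"
        proof (rule le_u)
          fix f assume f: "f \<in> C"
          show "t * u x \<le> f (t *\<^sub>R x)"
            using u_le[OF f, of x] sublinear_scaleR[OF sub[OF f] t, of x] t by (simp add: mult_left_mono)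
        qed
        ultimately show ?thesis using nz t by (simp add: divide_le_eq mult.commute)
      qed
      ultimately have "sublinear u" by (auto simp: sublinear_def)
      moreover have "u x \<le> p x" for x using False u_le fp by (meson all_not_in_conv order_trans)
      ultimately show ?thesis using u_le by (auto simp: A_def P_def)
    qed
  qed
  then obtain m where m: "m \<in> A" "\<And>a. a \<in> A \<Longrightarrow> P m a \<Longrightarrow> a = m" by blast
  show ?thesis
  proof (rule that)
    show "sublinear m" and mp: "m x \<le> p x" for x using m(1) by (auto simp: A_def)
    fix q assume "sublinear q" "\<And>x. q x \<le> m x"
    then show "q = m" using m(2)[of q] mp by (auto simp: A_def P_def intro: order_trans)
  qed
qed

text \<open>A minimal sublinear functional is linear because tilting cannot decrease it.\<close>

lemma Hahn_Banach_sublinear: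
  fixes p :: "'a::real_vector \<Rightarrow> real"
  assumes p: "sublinear p"
  obtains f where "linear f" "\<And>x. f x \<le> p x" "f a = p a"
proof -
  \<comment> \<open>Tilting at \<open>a\<close> first forces equality there: a linear
    \<open>f\<close> below \<open>p0\<close> has \<open>- f a = f (- a) \<le> - p a\<close>, while
    \<open>f a \<le> p a\<close>.\<close>
  obtain p0 where p0: "sublinear p0" "\<And>x. p0 x \<le> p x" "p0 (- a) \<le> - p a"
    using sublinear_tilt[OF p] by blast
  obtain f where f: "sublinear f" "\<And>x. f x \<le> p0 x"
    and min: "\<And>q. sublinear q \<Longrightarrow> (\<And>x. q x \<le> f x) \<Longrightarrow> q = f"
    using minimal_sublinear_exists[OF p0(1)] by blast
  have neg: "f (- y) = - f y" for y
  proof -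
    obtain q where "sublinear q" "\<And>x. q x \<le> f x" "q (- y) \<le> - f y"
      using sublinear_tilt[OF f(1)] by blast
    then have "f (- y) \<le> - f y" using min by blast
    then show ?thesis using sublinear_ge[OF f(1), of y] by simp
  qed
  have "linear f"
  proof (rule linearI)
    fix x y
    show "f (x + y) = f x + f y"
      using sublinear_add[OF f(1), of x y] sublinear_add[OF f(1), of "- x" "- y"]
        neg[of "x + y"] neg[of x] neg[of y] by simp
  next
    fix t x
    show "f (t *\<^sub>R x) = t *\<^sub>R f x"
    proof (cases "0 \<le> t")
      case True
      then show ?thesis by (simp add: sublinear_scaleR[OF f(1)])
    next
      case False
      then show ?thesis using sublinear_scaleR[OF f(1), of "- t" x] neg[of "t *\<^sub>R x"] by simp
    qed
  qed
  moreover have "f x \<le> p x" for x using f(2) p0(2) order_trans by blast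
  moreover from this have "f a = p a"
    using f(2)[of "- a"] p0(3) neg[of a] by (smt (verit))
  ultimately show ?thesis using that by blast
qed

section \<open>States\<close>

text \<open>For self-adjoint \<open>a\<close> this is the maximum of the spectrum of \<open>a\<close>.\<close>

definition upper_bound_functional :: "'a::real_normed_algebra_1 \<Rightarrow> real" where
  "upper_bound_functional a = Inf (range (\<lambda>t. norm (of_real t + a) - t))"

lemma bdd_below_upper_bound_functional:
  "bdd_below (range (\<lambda>t. norm (of_real t + a :: 'a::real_normed_algebra_1) - t))"
proof (rule bdd_belowI2)
  fix t
  show "- norm a \<le> norm (of_real t + a) - t"
    using norm_triangle_ineq4[of "of_real t + a" a] by simp
qed

lemma upper_bound_functional_le: "upper_bound_functional a \<le> norm (of_real t + a) - t"
  unfolding upper_bound_functional_def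
  by (intro cInf_lower bdd_below_upper_bound_functional) auto

lemma upper_bound_functional_greatest:
  "(\<And>t. c \<le> norm (of_real t + a) - t) \<Longrightarrow> c \<le> upper_bound_functional a"
  unfolding upper_bound_functional_def by (rule cInf_greatest) auto

lemma sublinear_upper_bound_functional:
  "sublinear (upper_bound_functional :: 'a::real_normed_algebra_1 \<Rightarrow> real)"
  unfolding sublinear_def
proof (intro conjI allI impI)
  fix x y :: 'a
  let ?p = "upper_bound_functional :: 'a \<Rightarrow> real"
  have "?p (x + y) - (norm (of_real s + y) - s) \<le> ?p x" for s
  proof (rule upper_bound_functional_greatest)
    fix t
    show "?p (x + y) - (norm (of_real s + y) - s) \<le> norm (of_real t + x) - t"
      using upper_bound_functional_le[of "x + y" "t + s"]
        norm_triangle_ineq[of "of_real t + x" "of_real s + y"]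
      by (simp add: algebra_simps)
  qed
  then have "?p (x + y) - ?p x \<le> ?p y"
    by (intro upper_bound_functional_greatest) (simp add: algebra_simps)
  then show "?p (x + y) \<le> ?p x + ?p y" by simp
next
  fix t :: real and x :: 'a
  let ?p = "upper_bound_functional :: 'a \<Rightarrow> real"
  assume "0 \<le> t"
  show "?p (t *\<^sub>R x) = t * ?p x"
  proof (cases "t = 0")
    case True
    have "?p 0 \<le> 0" using upper_bound_functional_le[of 0 0] by simp
    moreover have "0 \<le> ?p 0" by (rule upper_bound_functional_greatest) simp
    ultimately show ?thesis using True by simp
  next
    case False
    then have t: "0 < t" using \<open>0 \<le> t\<close> by simp
    have le: "?p (s *\<^sub>R z) \<le> s * ?p z" if s: "0 < s" for s z
    proof -
      have "?p (s *\<^sub>R z) / s \<le> ?p z"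
      proof (rule upper_bound_functional_greatest)
        fix r
        have "norm (of_real (s * r) + s *\<^sub>R z) = norm (s *\<^sub>R (of_real r + z))"
          by (simp add: of_real_def scaleR_add_right)
        also have "\<dots> = s * norm (of_real r + z)" using s by simp
        finally have "norm (of_real (s * r) + s *\<^sub>R z) = s * norm (of_real r + z)" .
        then have "?p (s *\<^sub>R z) \<le> s * (norm (of_real r + z) - r)"
          using upper_bound_functional_le[of "s *\<^sub>R z" "s * r"] s by (simp add: algebra_simps)
        then show "?p (s *\<^sub>R z) / s \<le> norm (of_real r + z) - r"
          using s by (simp add: divide_le_eq mult.commute)
      qed
      then show ?thesis using s by (simp add: divide_le_eq mult.commute)
    qed
    have "?p x \<le> (1 / t) * ?p (t *\<^sub>R x)" using le[of "1 / t" "t *\<^sub>R x"] t by simp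
    then have "t * ?p x \<le> ?p (t *\<^sub>R x)" using t by (simp add: le_divide_eq mult.commute)
    with le[OF t, of x] show ?thesis by simp
  qed
qed

text \<open>A shift \<open>t\<close> with \<open>norm (of_real t + a) < t + c\<close> makes
  \<open>t + c\<close> a centre for \<open>of_real c - a\<close>, as their difference is
  \<open>of_real t + a\<close>.\<close>

lemma cstar_positive_of_upper_bound_functional_less:
  assumes "star a = a" "upper_bound_functional a < c"
  shows "cstar_positive (of_real c - a)"
proof -
  obtain t where t: "norm (of_real t + a) - t < c"
    using assms(2) upper_bound_functional_greatest[of c a] by (meson not_le)
  then have "norm (of_real (t + c) - (of_real c - a)) \<le> t + c" by simp
  then show ?thesis using assms(1) by (intro cstar_positiveI[of _ "t + c"]) (simp_all add: star_diff)
qed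

text \<open>A real linear functional dominated by \<open>upper_bound_functional\<close> is
  automatically unital and nonnegative on positive elements; the Hahn-Banach theorem supplies one
  that is exact at \<open>a\<close>, and complexification makes it a state.\<close>

lemma state_attains_upper_bound_functional:
  fixes a :: "'a::unital_cstar_algebra"
  assumes a: "star a = a"
  obtains \<phi> where "\<phi> \<in> state_space" "\<phi> a = of_real (upper_bound_functional a)"
proof -
  let ?p = "upper_bound_functional :: 'a \<Rightarrow> real"
  obtain f where lin: "linear f" and fp: "\<And>x. f x \<le> ?p x" and fa: "f a = ?p a"
    using Hahn_Banach_sublinear[OF sublinear_upper_bound_functional] by blast
  \<comment> \<open>The shift 0 at \<open>1\<close> and the shift 1 at \<open>- 1\<close> bound
    \<open>f 1\<close> from both sides.\<close>
  have "f 1 \<le> 1" using fp[of 1] upper_bound_functional_le[of "1::'a" 0] by simp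
  moreover have "- f 1 \<le> - 1"
    using fp[of "- 1"] upper_bound_functional_le[of "- 1 :: 'a" 1] linear_neg[OF lin, of 1] by simp
  ultimately have f1: "f 1 = 1" by simp
  have fpos: "0 \<le> f x" if x: "cstar_positive x" for x
  proof -
    obtain t where "norm (of_real t - x) \<le> t" using x by (auto simp: cstar_positive_def)
    then show ?thesis
      using fp[of "- x"] upper_bound_functional_le[of "- x" t] linear_neg[OF lin, of x] by simp
  qed
  \<comment> \<open>Using only the self-adjoint part of \<open>x\<close> ensures that
    \<open>\<phi>\<close> is real on self-adjoint elements; \<open>\<phi>\<close> is the usual
    complex linear functional with real part \<open>g\<close>.\<close>
  define g where "g x = f ((1/2) *\<^sub>R (x + star x))" for x
  define \<phi> where "\<phi> x = Complex (g x) (- g (\<i> *\<^sub>C x))" for x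
  have g_add: "g (x + y) = g x + g y" for x y
  proof -
    have "(1/2) *\<^sub>R (x + y + star (x + y)) = (1/2) *\<^sub>R (x + star x) + (1/2) *\<^sub>R (y + star y)"
      by (simp add: star_add algebra_simps)
    then show ?thesis by (simp only: g_def linear_add[OF lin])
  qed
  have g_scale: "g (r *\<^sub>R x) = r * g x" for r x
  proof -
    have "(1/2) *\<^sub>R (r *\<^sub>R x + star (r *\<^sub>R x)) = r *\<^sub>R ((1/2) *\<^sub>R (x + star x))"
      by (simp add: star_scaleR scaleR_add_right mult.commute)
    then show ?thesis by (simp only: g_def linear_scale[OF lin] real_scaleR_def)
  qed
  have g_sa: "g x = f x" if "star x = x" for x using that by (simp add: g_def flip: scaleR_2)
  have g_i: "g (\<i> *\<^sub>C x) = 0" if "star x = x" for x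
    using that by (simp add: g_def star_scaleC scaleC_uminus_left linear_0[OF lin])
  have \<phi>_sa: "\<phi> x = of_real (f x)" if "star x = x" for x
    using that by (simp add: \<phi>_def g_sa g_i complex_eq_iff)
  have "\<phi> (x + y) = \<phi> x + \<phi> y" for x y
    by (simp add: \<phi>_def g_add scaleC_add_right complex_eq_iff)
  moreover have "\<phi> (c *\<^sub>C x) = c * \<phi> x" for c x
  proof -
    have c: "c *\<^sub>C x = Re c *\<^sub>R x + Im c *\<^sub>R (\<i> *\<^sub>C x)" for x
    proof -
      have "c = of_real (Re c) + of_real (Im c) * \<i>" by (simp add: complex_eq_iff)
      then have "c *\<^sub>C x = (of_real (Re c) + of_real (Im c) * \<i>) *\<^sub>C x" by (rule arg_cong)
      then show ?thesis by (simp only: scaleC_add_left scaleR_eq_scaleC scaleC_scaleC)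
    qed
    have "\<i> *\<^sub>C (c *\<^sub>C x) = c *\<^sub>C (\<i> *\<^sub>C x)" by (simp add: scaleC_scaleC mult.commute)
    also have "\<dots> = Re c *\<^sub>R (\<i> *\<^sub>C x) + (- Im c) *\<^sub>R x" by (subst c) (simp add: scaleC_ii)
    finally have ic: "\<i> *\<^sub>C (c *\<^sub>C x) = Re c *\<^sub>R (\<i> *\<^sub>C x) + (- Im c) *\<^sub>R x" .
    show ?thesis
      unfolding \<phi>_def ic unfolding c[of x] g_add g_scale
      by (simp add: complex_eq_iff algebra_simps)
  qed
  moreover have "\<phi> (star x * x) \<in> \<real>\<^sub>\<ge>\<^sub>0" for x
    using fpos[OF cstar_positive_star_mult_self[of x]]
    by (subst \<phi>_sa) (simp_all add: star_mult star_star)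
  moreover have "\<phi> 1 = 1" by (simp add: \<phi>_sa f1)
  ultimately have "\<phi> \<in> state_space" by (simp add: state_space_def complex_linear_def)
  moreover have "\<phi> a = of_real (?p a)" by (simp add: \<phi>_sa[OF a] fa)
  ultimately show ?thesis using that by blast
qed

section \<open>Oscillation over the states and distance to the scalars\<close>

text \<open>The spectral width \<open>?p a + ?p (- a)\<close> is the difference of the values of two
  states at \<open>a\<close>, hence at most \<open>R\<close>; an interval slightly wider than this
  squeezes \<open>a\<close> between two scalars.\<close>

lemma norm_minus_scalar_le:
  fixes a :: "'a::unital_cstar_algebra"
  assumes a: "star a = a" and R: "\<And>\<phi> \<psi>. \<phi> \<in> state_space \<Longrightarrow> \<psi> \<in> state_space \<Longrightarrow> cmod (\<phi> a - \<psi> a) \<le> R"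
  obtains s where "norm (a - of_real s) \<le> R + 1"
proof -
  let ?p = "upper_bound_functional :: 'a \<Rightarrow> real"
  have ma: "star (- a) = - a" by (simp add: star_minus a)
  obtain \<phi> where \<phi>: "\<phi> \<in> state_space" "\<phi> a = of_real (?p a)"
    using state_attains_upper_bound_functional[OF a] by blast
  obtain \<psi> where \<psi>: "\<psi> \<in> state_space" "\<psi> (- a) = of_real (?p (- a))"
    using state_attains_upper_bound_functional[OF ma] by blast
  have "\<psi> (- a) = - \<psi> a"
    using \<psi>(1) scaleR_eq_scaleC[of "-1" a] by (auto simp: state_space_def complex_linear_def)
  then have "\<phi> a - \<psi> a = of_real (?p a + ?p (- a))" using \<phi> \<psi> by simp
  then have "cmod (\<phi> a - \<psi> a) = \<bar>?p a + ?p (- a)\<bar>" by (simp only: norm_of_real)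
  then have le: "?p a + ?p (- a) \<le> R" using R[OF \<phi>(1) \<psi>(1)] by linarith
  \<comment> \<open>Positivity of \<open>of_real c - a\<close> was derived from a strict inequality;
    the two halves add up to the 1 in \<open>R + 1\<close>.\<close>
  define c where "c = ?p a + 1/2"
  define d where "d = ?p (- a) + 1/2"
  have ca: "cstar_positive (of_real c - a)"
    using a by (rule cstar_positive_of_upper_bound_functional_less) (simp add: c_def)
  have da: "cstar_positive (of_real d - - a)"
    using ma by (rule cstar_positive_of_upper_bound_functional_less) (simp add: d_def)
  have "of_real (c + d) - (of_real d - - a) = of_real c - a" by simp
  then have "norm (of_real d - - a) \<le> c + d"
    using norm_le_of_cstar_positive[OF da, of "c + d"] ca by argo
  moreover have "a - of_real (- d) = of_real d - - a" by simp
  moreover have "c + d \<le> R + 1" using le by (simp add: c_def d_def)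
  ultimately have "norm (a - of_real (- d)) \<le> R + 1" by (metis order_trans)
  then show ?thesis using that by blast
qed

section \<open>Pointwise bounds, convexity and diameter of the state space\<close>

lemma state_scaleR:
  assumes "\<phi> \<in> state_space"
  shows "\<phi> (r *\<^sub>R x) = of_real r * \<phi> x"
  using assms by (simp add: state_space_def complex_linear_def scaleR_eq_scaleC)

lemma state_add:
  assumes "\<phi> \<in> state_space"
  shows "\<phi> (x + y) = \<phi> x + \<phi> y"
  using assms by (simp add: state_space_def complex_linear_def)

lemma state_diff:
  assumes "\<phi> \<in> state_space"
  shows "\<phi> (x - y) = \<phi> x - \<phi> y"
  using state_add[OF assms, of "x - y" y] by simp

text \<open>After scaling to norm below 1, both \<open>1 - c\<close> and \<open>1 + c\<close> are
  squares, so a state maps \<open>c\<close> into the real interval from -1 to 1. The scaling factor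
  \<open>norm a + 1\<close> is the bound.\<close>

lemma state_bound_self_adjoint:
  assumes \<phi>: "\<phi> \<in> state_space" and a: "star a = a"
  shows "cmod (\<phi> a) \<le> norm a + 1"
proof -
  define s where "s = norm a + 1"
  have s: "0 < s" by (simp add: s_def add_nonneg_pos)
  define c where "c = (1 / s) *\<^sub>R a"
  have sc: "star c = c" "star (- c) = - c" by (simp_all add: c_def star_scaleR star_minus a)
  have nc: "norm c < 1" "norm (- c) < 1" using s by (simp_all add: c_def s_def)
  have pos: "\<phi> (b * b) \<in> \<real>\<^sub>\<ge>\<^sub>0" if "star b = b" for b
    using \<phi> that by (auto simp: state_space_def dest: spec[of _ b])
  obtain b where b: "star b = b" "b * b = 1 - c" using sqrt_one_minus[OF sc(1) nc(1)] by blast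
  obtain d where d: "star d = d" "d * d = 1 - - c" using sqrt_one_minus[OF sc(2) nc(2)] by blast
  have "\<phi> 1 = 1" using \<phi> by (simp add: state_space_def)
  then have "1 - \<phi> c \<in> \<real>\<^sub>\<ge>\<^sub>0" "1 + \<phi> c \<in> \<real>\<^sub>\<ge>\<^sub>0"
    using pos[OF b(1)] pos[OF d(1)] by (simp_all add: b d state_diff[OF \<phi>] state_add[OF \<phi>])
  then have "Im (\<phi> c) = 0" "Re (\<phi> c) \<le> 1" "- 1 \<le> Re (\<phi> c)"
    by (auto simp: complex_nonneg_Reals_iff)
  then have "cmod (\<phi> c) \<le> 1" by (simp add: cmod_def)
  moreover have "\<phi> a = of_real s * \<phi> c" using s by (simp add: c_def state_scaleR[OF \<phi>])
  ultimately show ?thesis using s by (simp add: norm_mult flip: s_def)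
qed

text \<open>\<open>2 x = a - i b\<close> with self-adjoint \<open>a\<close> and \<open>b\<close> of
  norm at most \<open>2 * norm x\<close>.\<close>

lemma state_bound:
  assumes \<phi>: "\<phi> \<in> state_space"
  shows "cmod (\<phi> x) \<le> 2 * norm x + 2"
proof -
  define a where "a = x + star x"
  define b where "b = \<i> *\<^sub>C (x - star x)"
  have "star a = a" by (simp add: a_def star_add star_star add.commute)
  moreover have "norm a \<le> 2 * norm x" using norm_triangle_ineq[of x "star x"] by (simp add: a_def)
  ultimately have A: "cmod (\<phi> a) \<le> 2 * norm x + 1"
    using state_bound_self_adjoint[OF \<phi>, of a] by simp
  have "star b = b"
    by (simp add: b_def star_scaleC star_diff star_star scaleC_uminus_left scaleC_diff_right)
  moreover have "norm b \<le> 2 * norm x"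
    using norm_triangle_ineq4[of x "star x"] by (simp add: b_def norm_scaleC)
  ultimately have B: "cmod (\<phi> b) \<le> 2 * norm x + 1"
    using state_bound_self_adjoint[OF \<phi>, of b] by simp
  have "a - \<i> *\<^sub>C b = 2 *\<^sub>R x" by (simp add: a_def b_def scaleC_ii scaleR_2)
  then have "\<phi> (2 *\<^sub>R x) = \<phi> a - \<i> * \<phi> b"
    using \<phi> state_diff[OF \<phi>, of a "\<i> *\<^sub>C b"] by (simp add: state_space_def complex_linear_def)
  then have "2 * \<phi> x = \<phi> a - \<i> * \<phi> b" by (simp add: state_scaleR[OF \<phi>])
  then have "2 * cmod (\<phi> x) = cmod (\<phi> a - \<i> * \<phi> b)" by (metis norm_mult norm_numeral)
  also have "\<dots> \<le> cmod (\<phi> a) + cmod (\<phi> b)"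
    using norm_triangle_ineq4[of "\<phi> a" "\<i> * \<phi> b"] by (simp add: norm_mult)
  finally show ?thesis using A B by simp
qed

lemma state_convex:
  assumes "\<phi> \<in> state_space" "\<psi> \<in> state_space" "0 \<le> s" "s \<le> 1"
  shows "(\<lambda>x. \<phi> x + of_real s * (\<psi> x - \<phi> x)) \<in> state_space"
proof -
  have pos: "\<phi> (star x * x) + of_real s * (\<psi> (star x * x) - \<phi> (star x * x)) \<in> \<real>\<^sub>\<ge>\<^sub>0" for x
  proof -
    have "\<phi> (star x * x) \<in> \<real>\<^sub>\<ge>\<^sub>0" "\<psi> (star x * x) \<in> \<real>\<^sub>\<ge>\<^sub>0" using assms by (auto simp: state_space_def)
    moreover have "of_real s \<in> (\<real>\<^sub>\<ge>\<^sub>0 :: complex set)" "of_real (1 - s) \<in> (\<real>\<^sub>\<ge>\<^sub>0 :: complex set)"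
      using assms(3,4) by (simp_all del: of_real_diff)
    ultimately have "of_real (1 - s) * \<phi> (star x * x) + of_real s * \<psi> (star x * x) \<in> \<real>\<^sub>\<ge>\<^sub>0"
      by (intro nonneg_Reals_add_I nonneg_Reals_mult_I)
    then show ?thesis by (simp add: algebra_simps)
  qed
  show ?thesis
    using assms(1,2) pos by (simp add: state_space_def complex_linear_def algebra_simps)
qed

text \<open>A weak* neighbourhood of \<open>\<phi>\<close> of Monge-Kantorovich radius 1 contains, by convexity and
  pointwise boundedness of the states, a fixed proportion \<open>s\<close> of every segment from \<open>\<phi>\<close>.
  No appeal to weak* compactness is needed.\<close>

lemma quantum_compact_metric_space_diameter:
  assumes Q: "quantum_compact_metric_space D L"
  obtains R where "\<And>\<phi> \<psi> a. \<lbrakk>\<phi> \<in> state_space; \<psi> \<in> state_space; a \<in> D; L a \<le> 1\<rbrakk> \<Longrightarrow> cmod (\<phi> a - \<psi> a) \<le> R"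
proof (cases "state_space = ({} :: ('a \<Rightarrow> complex) set)")
  case True
  then show ?thesis using that by blast
next
  case False
  then obtain \<phi> :: "'a \<Rightarrow> complex" where \<phi>: "\<phi> \<in> state_space" by blast
  let ?d = "\<lambda>x y. enn2real (monge_kantorovich D L x y)"
  have fin: "\<And>x y. x \<in> state_space \<Longrightarrow> y \<in> state_space \<Longrightarrow> monge_kantorovich D L x y < \<infinity>"
    and ms: "Metric_space state_space ?d"
    and top: "Metric_space.mtopology state_space ?d = weak_star_topology"
    using Q unfolding quantum_compact_metric_space_def metrizes_def by blast+
  interpret Metric_space state_space ?d by (rule ms)
  have "openin weak_star_topology (mball \<phi> 1)" using openin_mball[of \<phi> 1] by (simp only: top)
  then obtain T where T: "openin (product_topology (\<lambda>_. euclidean) UNIV) T"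
    and ball: "mball \<phi> 1 = T \<inter> state_space"
    unfolding weak_star_topology_def openin_subtopology by blast
  have "\<phi> \<in> T" using ball \<phi> by auto
  from bspec[OF T[unfolded openin_product_topology_alt] this] obtain U where "finite {i \<in> UNIV. U i \<noteq> topspace (euclidean :: complex topology)}"
    "\<forall>i\<in>UNIV. openin euclidean (U i)" and U: "\<phi> \<in> Pi\<^sub>E UNIV U" "Pi\<^sub>E UNIV U \<subseteq> T"
    by (elim exE conjE)
  then have fin_U: "finite {i. U i \<noteq> UNIV}" and open_U: "\<And>i. open (U i)" by simp_all
  have near: "\<forall>\<^sub>F s in at_right 0. \<forall>\<psi>\<in>state_space. \<phi> i + of_real s * (\<psi> i - \<phi> i) \<in> U i" for i
  proof -
    \<comment> \<open>\<open>M\<close> bounds the difference of any two states at \<open>i\<close>,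
      so the admissible range \<open>s < \<epsilon> / M\<close> is the same for all
      \<open>\<psi>\<close>.\<close>
    define M where "M = 4 * norm i + 4"
    have M: "0 < M" by (simp add: M_def add_nonneg_pos)
    have "\<phi> i \<in> U i" using U(1) by auto
    then obtain \<epsilon> where \<epsilon>: "0 < \<epsilon>" "ball (\<phi> i) \<epsilon> \<subseteq> U i" using open_U open_contains_ball by blast
    have "\<phi> i + of_real s * (\<psi> i - \<phi> i) \<in> U i"
      if s: "0 < s" "s < \<epsilon> / M" and \<psi>: "\<psi> \<in> state_space" for s \<psi>
    proof -
      have "cmod (\<psi> i - \<phi> i) \<le> M"
        using norm_triangle_ineq4[of "\<psi> i" "\<phi> i"] state_bound[OF \<phi>, of i] state_bound[OF \<psi>, of i]
        by (simp add: M_def)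
      then have "s * cmod (\<psi> i - \<phi> i) \<le> s * M" using s by (intro mult_left_mono) auto
      also have "\<dots> < \<epsilon>" using s M by (simp add: less_divide_eq)
      finally have "\<phi> i + of_real s * (\<psi> i - \<phi> i) \<in> ball (\<phi> i) \<epsilon>"
        using s by (simp add: dist_norm norm_mult)
      then show ?thesis using \<epsilon>(2) by blast
    qed
    moreover have "0 < \<epsilon> / M" using \<epsilon>(1) M by simp
    ultimately show ?thesis unfolding eventually_at_right_field by blast
  qed
  \<comment> \<open>A basic open set restricts only finitely many coordinates, so a single
    \<open>s\<close> serves them all.\<close>
  have "\<forall>\<^sub>F s in at_right 0. \<forall>i\<in>{i. U i \<noteq> UNIV}. \<forall>\<psi>\<in>state_space. \<phi> i + of_real s * (\<psi> i - \<phi> i) \<in> U i"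
    by (rule eventually_ball_finite[OF fin_U]) (use near in blast)
  moreover have "\<forall>\<^sub>F s in at_right (0::real). s < 1"
    unfolding eventually_at_right_field by (rule exI[of _ 1]) simp
  moreover have "\<forall>\<^sub>F s in at_right (0::real). 0 < s" by (rule eventually_at_right_less)
  ultimately have "\<forall>\<^sub>F s in at_right 0. 0 < s \<and> s < 1 \<and>
      (\<forall>i\<in>{i. U i \<noteq> UNIV}. \<forall>\<psi>\<in>state_space. \<phi> i + of_real s * (\<psi> i - \<phi> i) \<in> U i)"
    by eventually_elim blast
  then obtain s where s: "0 < s" "s < 1"
    "\<And>i \<psi>. U i \<noteq> UNIV \<Longrightarrow> \<psi> \<in> state_space \<Longrightarrow> \<phi> i + of_real s * (\<psi> i - \<phi> i) \<in> U i"
    using eventually_happens'[OF trivial_limit_at_right_real] by blast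
  have bound: "cmod (\<phi> a - \<psi> a) \<le> 1 / s" if \<psi>: "\<psi> \<in> state_space" and a: "a \<in> D" "L a \<le> 1" for \<psi> a
  proof -
    \<comment> \<open>The point at proportion \<open>s\<close> of the segment lies in the unit ball
      around \<open>\<phi>\<close>, and its difference from \<open>\<phi>\<close> is
      \<open>s\<close> times that of \<open>\<psi>\<close>.\<close>
    define \<xi> where "\<xi> x = \<phi> x + of_real s * (\<psi> x - \<phi> x)" for x
    have \<xi>: "\<xi> \<in> state_space" unfolding \<xi>_def using s by (intro state_convex \<phi> \<psi>) auto
    have "\<xi> \<in> Pi\<^sub>E UNIV U" using s(3)[OF _ \<psi>] by (fastforce simp: \<xi>_def)
    then have "\<xi> \<in> mball \<phi> 1" using U(2) \<xi> ball by blast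
    then have "?d \<phi> \<xi> < 1" by simp
    moreover have "ennreal (cmod (\<phi> a - \<xi> a)) \<le> monge_kantorovich D L \<phi> \<xi>"
      unfolding monge_kantorovich_def using a by (intro SUP_upper) simp
    \<comment> \<open>Finiteness matters here, since \<open>enn2real\<close> sends infinity to
      0.\<close>
    then have "cmod (\<phi> a - \<xi> a) \<le> ?d \<phi> \<xi>"
      using fin[OF \<phi> \<xi>] by (metis enn2real_ennreal enn2real_mono infinity_ennreal_def norm_ge_zero)
    moreover have "cmod (\<phi> a - \<xi> a) = s * cmod (\<phi> a - \<psi> a)"
      using s(1) by (simp add: \<xi>_def norm_mult norm_minus_commute)
    ultimately show ?thesis using s(1) by (simp add: le_divide_eq mult.commute)
  qed
  show ?thesis
  proof (rule that)
    fix \<psi>1 \<psi>2 :: "'a \<Rightarrow> complex" and a :: 'a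
    assume *: "\<psi>1 \<in> state_space" "\<psi>2 \<in> state_space" "a \<in> D" "L a \<le> 1"
    have "cmod (\<psi>1 a - \<psi>2 a) \<le> cmod (\<phi> a - \<psi>2 a) + cmod (\<phi> a - \<psi>1 a)"
      using norm_triangle_ineq4[of "\<phi> a - \<psi>2 a" "\<phi> a - \<psi>1 a"] by simp
    then show "cmod (\<psi>1 a - \<psi>2 a) \<le> 2 / s"
      using bound[OF *(1,3,4)] bound[OF *(2,3,4)] by simp
  qed
qed

section \<open>Lower semicontinuous seminorms\<close>

text \<open>By homogeneity the sublevel set is the unit one dilated by \<open>c\<close>.\<close>

lemma seminorm_on_sublevel_closed:
  fixes D :: "'a::real_normed_vector set"
  assumes p: "seminorm_on D p" and lsc: "lower_semicontinuous_seminorm D p" and c: "0 < c"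
  shows "closed {a \<in> D. p a \<le> c}"
proof -
  have sub: "subspace D" and hom: "\<And>t x. x \<in> D \<Longrightarrow> p (t *\<^sub>R x) = \<bar>t\<bar> * p x"
    using p by (auto simp: seminorm_on_def)
  have "{a \<in> D. p a \<le> c} = (\<lambda>x. c *\<^sub>R x) ` {a \<in> D. p a \<le> 1}"
  proof (intro set_eqI iffI)
    fix a assume a: "a \<in> {a \<in> D. p a \<le> c}"
    then have "(1 / c) *\<^sub>R a \<in> {a \<in> D. p a \<le> 1}"
      using c sub by (simp add: hom subspace_scale)
    moreover have "a = c *\<^sub>R ((1 / c) *\<^sub>R a)" using c by simp
    ultimately show "a \<in> (\<lambda>x. c *\<^sub>R x) ` {a \<in> D. p a \<le> 1}" by blast
  next
    fix a assume "a \<in> (\<lambda>x. c *\<^sub>R x) ` {a \<in> D. p a \<le> 1}"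
    then show "a \<in> {a \<in> D. p a \<le> c}"
      using c sub by (auto simp: hom subspace_scale mult_left_le)
  qed
  then show ?thesis using lsc by (simp add: lower_semicontinuous_seminorm_def closed_scaling)
qed

text \<open>Baire's theorem gives a relative ball of \<open>K\<close> around some \<open>z\<close>
  on which \<open>p\<close> is bounded; contracting \<open>K\<close> towards \<open>z\<close> by a
  fixed factor \<open>t\<close> moves all of it into that ball.\<close>

lemma seminorm_bounded_on_complete_convex:
  fixes K :: "'a::banach set"
  assumes p: "seminorm_on D p" and lsc: "lower_semicontinuous_seminorm D p"
    and K: "closed K" "convex K" "bounded K" "K \<noteq> {}" "K \<subseteq> D"
  obtains C where "\<And>a. a \<in> K \<Longrightarrow> p a \<le> C"
proof -
  have sub: "subspace D" and hom: "\<And>t x. x \<in> D \<Longrightarrow> p (t *\<^sub>R x) = \<bar>t\<bar> * p x"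
    and tri: "\<And>x y. x \<in> D \<Longrightarrow> y \<in> D \<Longrightarrow> p (x + y) \<le> p x + p y"
    and nn: "\<And>x. x \<in> D \<Longrightarrow> 0 \<le> p x"
    using p by (auto simp: seminorm_on_def)
  \<comment> \<open>\<open>Suc n\<close> keeps every level positive, as closedness of the sublevel
    set requires.\<close>
  define F where "F n = K \<inter> {a \<in> D. p a \<le> real (Suc n)}" for n
  have "closed (F n)" for n
    unfolding F_def by (intro closed_Int K seminorm_on_sublevel_closed[OF p lsc]) simp
  then have clF: "closedin (top_of_set K) (F n)" for n
    by (intro closed_subset) (auto simp: F_def)
  have "\<Union> (range F) = K"
  proof
    show "K \<subseteq> \<Union> (range F)"
    proof
      fix a assume a: "a \<in> K"
      obtain n where "p a \<le> real n" using real_arch_simple by blast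
      then have "a \<in> F n" using a K(5) by (auto simp: F_def)
      then show "a \<in> \<Union> (range F)" by blast
    qed
  qed (auto simp: F_def)
  then have "top_of_set K interior_of \<Union> (range F) \<noteq> {}"
    using K(4) interior_of_topspace[of "top_of_set K"] by simp
  moreover have "completely_metrizable_space (top_of_set K)"
    using K(1) completely_metrizable_space_closedin completely_metrizable_space_euclidean closed_closedin
    by blast
  ultimately obtain n where "top_of_set K interior_of F n \<noteq> {}"
    using Baire_category_alt[of "top_of_set K" "range F"] clF by auto
  then obtain z where "z \<in> top_of_set K interior_of F n" by blast
  then obtain V where V: "openin (top_of_set K) V" "z \<in> V" "V \<subseteq> F n"
    unfolding interior_of_def by blast
  then obtain e where e: "0 < e" "ball z e \<inter> K \<subseteq> V" unfolding openin_contains_ball by meson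
  have z: "z \<in> K" "z \<in> D" "p z \<le> real (Suc n)" using V(2,3) by (auto simp: F_def)
  obtain B where B: "0 < B" "\<And>a. a \<in> K \<Longrightarrow> norm a \<le> B" using K(3) bounded_pos by blast
  \<comment> \<open>Two points of \<open>K\<close> are at most \<open>2 * B\<close> apart, so the
    contracted point stays within \<open>e / 2\<close> of \<open>z\<close>; the minimum with 1 keeps
    the combination convex.\<close>
  define t where "t = min 1 (e / (4 * B))"
  have t: "0 < t" "t \<le> 1" using e B by (simp_all add: t_def)
  have "t * (4 * B) \<le> e" using B(1) by (simp add: t_def min_def field_simps)
  then have tB: "t * (2 * B) < e" using e(1) by linarith
  show ?thesis
  proof (rule that)
    fix a assume a: "a \<in> K"
    then have aD: "a \<in> D" using K(5) by blast
    define y where "y = (1 - t) *\<^sub>R z + t *\<^sub>R a"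
    have yK: "y \<in> K" unfolding y_def using K(2) z(1) a t by (intro convexD) auto
    have "norm (y - z) = t * norm (a - z)"
    proof -
      have "y - z = t *\<^sub>R (a - z)" by (simp add: y_def algebra_simps)
      then show ?thesis using t by simp
    qed
    also have "\<dots> \<le> t * (2 * B)"
      using norm_triangle_ineq4[of a z] B(2)[OF a] B(2)[OF z(1)] t by (intro mult_left_mono) auto
    also note tB
    finally have "norm (y - z) < e" .
    then have "y \<in> ball z e" by (simp add: dist_norm norm_minus_commute)
    then have "y \<in> F n" using e V yK by blast
    then have y: "y \<in> D" "p y \<le> real (Suc n)" by (auto simp: F_def)
    have "t *\<^sub>R a = y + (- (1 - t)) *\<^sub>R z" by (simp add: y_def algebra_simps)
    then have "p (t *\<^sub>R a) \<le> p y + p ((- (1 - t)) *\<^sub>R z)"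
      using tri y(1) subspace_scale[OF sub z(2)] by metis
    also have "\<dots> \<le> real (Suc n) + p z"
      using y(2) t hom[OF z(2), of "- (1 - t)"] nn[OF z(2)]
      by (simp add: add_mono mult_left_le_one_le)
    finally have "t * p a \<le> 2 * real (Suc n)" using t z(3) hom[OF aD, of t] by simp
    then show "p a \<le> 2 * real (Suc n) / t" using t by (simp add: le_divide_eq mult.commute)
  qed
qed

section \<open>Comparison of the two seminorms\<close>

theorem theorem2p2:
  fixes domL :: "'a::unital_cstar_algebra set"
    and L S :: "'a \<Rightarrow> real"
  assumes "quantum_compact_metric_space domL L"
    and "lower_semicontinuous_seminorm domL L"
    and "seminorm_on domL S"
    and "lower_semicontinuous_seminorm domL S"
    and "S 1 = 0"
  shows "\<exists>C>0. \<forall>a\<in>domL. S a \<le> C * L a"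
proof -
  have sa: "\<And>a. a \<in> domL \<Longrightarrow> star a = a" and snL: "seminorm_on domL L"
    and ker: "{a \<in> domL. L a = 0} = range (\<lambda>t::real. t *\<^sub>R 1)"
    using assms(1) by (auto simp: quantum_compact_metric_space_def self_adjoint_def)
  have sub: "subspace domL" and nnL: "\<And>x. x \<in> domL \<Longrightarrow> 0 \<le> L x"
    and triL: "\<And>x y. x \<in> domL \<Longrightarrow> y \<in> domL \<Longrightarrow> L (x + y) \<le> L x + L y"
    and homL: "\<And>t x. x \<in> domL \<Longrightarrow> L (t *\<^sub>R x) = \<bar>t\<bar> * L x"
    using snL by (auto simp: seminorm_on_def)
  have triS: "\<And>x y. x \<in> domL \<Longrightarrow> y \<in> domL \<Longrightarrow> S (x + y) \<le> S x + S y"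
    and homS: "\<And>t x. x \<in> domL \<Longrightarrow> S (t *\<^sub>R x) = \<bar>t\<bar> * S x"
    using assms(3) by (auto simp: seminorm_on_def)
  have scalar: "of_real t \<in> domL" "L (of_real t) = 0" for t
    using ker by (auto simp: of_real_def set_eq_iff)
  have "S (t *\<^sub>R 1) = 0" for t using homS[of 1 t] scalar(1)[of 1] assms(5) by simp
  then have S_scalar: "S (of_real t) = 0" for t by (simp add: of_real_def)
  obtain R where R: "\<And>\<phi> \<psi> a. \<lbrakk>\<phi> \<in> state_space; \<psi> \<in> state_space; a \<in> domL; L a \<le> 1\<rbrakk>
      \<Longrightarrow> cmod (\<phi> a - \<psi> a) \<le> R"
    using quantum_compact_metric_space_diameter[OF assms(1)] by blast
  \<comment> \<open>The radius covers the distance \<open>R + 1\<close> to the scalars; the absolute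
    value ensures \<open>0 \<in> K\<close> whatever the sign of \<open>R\<close>.\<close>
  define K where "K = {a \<in> domL. L a \<le> 1} \<inter> cball 0 (\<bar>R\<bar> + 1)"
  have "closed K"
    unfolding K_def using assms(2) by (auto simp: lower_semicontinuous_seminorm_def)
  moreover have "convex {a \<in> domL. L a \<le> 1}"
  proof (rule convexI)
    fix x y and u v :: real
    assume *: "x \<in> {a \<in> domL. L a \<le> 1}" "y \<in> {a \<in> domL. L a \<le> 1}" "0 \<le> u" "0 \<le> v" "u + v = 1"
    then have D: "u *\<^sub>R x \<in> domL" "v *\<^sub>R y \<in> domL" by (auto intro: subspace_scale[OF sub])
    have "L (u *\<^sub>R x + v *\<^sub>R y) \<le> u * L x + v * L y" using triL[OF D] * by (simp add: homL)
    also have "\<dots> \<le> u * 1 + v * 1" using * by (intro add_mono mult_left_mono) auto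
    finally show "u *\<^sub>R x + v *\<^sub>R y \<in> {a \<in> domL. L a \<le> 1}"
      using D * by (simp add: subspace_add[OF sub])
  qed
  then have "convex K" unfolding K_def by (intro convex_Int convex_cball)
  moreover have "bounded K" by (auto simp: K_def)
  moreover have "0 \<in> K" using scalar[of 0] by (simp add: K_def)
  moreover have "K \<subseteq> domL" by (auto simp: K_def)
  ultimately obtain C where C: "\<And>a. a \<in> K \<Longrightarrow> S a \<le> C"
    using seminorm_bounded_on_complete_convex[OF assms(3,4), of K] by blast
  have unit: "S a \<le> C" if a: "a \<in> domL" "L a \<le> 1" for a
  proof -
    obtain s where s: "norm (a - of_real s) \<le> R + 1"
      using norm_minus_scalar_le[OF sa[OF a(1)], of R] R a by blast
    have "L (a + of_real (- s)) \<le> 1" using triL[OF a(1) scalar(1)[of "- s"]] scalar(2)[of "- s"] a(2) by simp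
    moreover have D: "a - of_real s \<in> domL" using a(1) scalar(1) by (rule subspace_diff[OF sub])
    ultimately have "S (a - of_real s) \<le> C" using s by (intro C) (simp add: K_def)
    moreover have "S a \<le> S (a - of_real s) + S (of_real s)"
      using triS[OF D scalar(1)[of s]] by simp
    ultimately show ?thesis by (simp add: S_scalar)
  qed
  have "S a \<le> max C 1 * L a" if a: "a \<in> domL" for a
  \<comment> \<open>Normalising by \<open>L a\<close> fails exactly on the kernel of
    \<open>L\<close>, which consists of scalars, where \<open>S\<close> vanishes too.\<close>
  proof (cases "L a = 0")
    case True
    then obtain t where "a = of_real t" using a ker by (auto simp: of_real_def set_eq_iff)
    then show ?thesis using True by (simp add: S_scalar)
  next
    case False
    then have pos: "0 < L a" using nnL[OF a] by simp
    have "S ((1 / L a) *\<^sub>R a) \<le> C"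
      using pos by (intro unit) (simp_all add: homL[OF a] subspace_scale[OF sub a])
    then have "S a \<le> C * L a" using pos by (simp add: homS[OF a] divide_le_eq)
    also have "\<dots> \<le> max C 1 * L a" using pos by (intro mult_right_mono) auto
    finally show ?thesis .
  qed
  moreover have "0 < max C 1" by simp
  ultimately show ?thesis by blast
qed

end
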